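(* Let $n\ge3$ and let $H=H(u,x^3,\dots,x^n)$ be any smooth function on $\mathbb{R}^n$ with global coordinates $(v,u,x^3,\dots,x^n)$, independent of $v$. Let $h=H\,du^2+2\,dv\,du+\sum_{i=3}^{n}(dx^i)^2$, let $T=\tfrac12(H+1)\partial_v-\partial_u$, and let $g=h+2T^\flat\otimes T^\flat$ with $T^\flat=h(T,\cdot)$ be the standard Riemannian dual of $h$. Then $g$ is a complete Riemannian metric on $\mathbb{R}^n$. Furthermore, $\partial_v$ is a Killing vector field of constant length with respect to $g$.
   Context: $dv\,du$ is the symmetric product, so $h(\partial_v,\partial_u)=1$, $h(\partial_u,\partial_u)=H$, $h(\partial_v,\partial_v)=0$; $h$ is a Lorentzian metric (a standard pp-wave) and $h(T,T)=-1$. "Complete" means geodesically complete. *)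

theory Defs
  imports "HOL-Analysis.Analysis"
begin

primrec differentiable_class :: "nat \<Rightarrow> ('a::euclidean_space \<Rightarrow> 'b::real_normed_vector) \<Rightarrow> bool" where
  "differentiable_class 0 f \<longleftrightarrow> continuous_on UNIV f"
| "differentiable_class (Suc k) f \<longleftrightarrow> (\<forall>x. f differentiable at x) \<and>
     (\<forall>w. differentiable_class k (\<lambda>x. frechet_derivative f (at x) w))"

definition smooth_map :: "('a::euclidean_space \<Rightarrow> 'b::real_normed_vector) \<Rightarrow> bool" where
  "smooth_map f \<longleftrightarrow> (\<forall>k. differentiable_class k f)"

text \<open>The manifold is a Euclidean space \<open>'a\<close> with its global linear coordinates, so every tangent
  space is identified with \<open>'a\<close>: a vector field is a function \<open>'a \<Rightarrow> 'a\<close>, and a covariant 2-tensor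
  field \<open>g\<close> maps a point and two tangent vectors to \<open>g p X Y\<close>.\<close>

type_synonym 'a tensor2 = "'a \<Rightarrow> 'a \<Rightarrow> 'a \<Rightarrow> real"

definition riemannian_metric :: "'a::euclidean_space tensor2 \<Rightarrow> bool" where
  "riemannian_metric g \<longleftrightarrow>
     (\<forall>p. bilinear (g p)) \<and>
     (\<forall>p X Y. g p X Y = g p Y X) \<and>
     (\<forall>p X. X \<noteq> 0 \<longrightarrow> g p X X > 0) \<and>
     (\<forall>X Y. smooth_map (\<lambda>p. g p X Y))"

text \<open>\<open>koszul g p X Y Z\<close> is the right-hand side of the Koszul formula for
  \<open>g (\<nabla>\<^sub>X Y) Z\<close> at \<open>p\<close>, where \<open>X\<close>, \<open>Y\<close>, \<open>Z\<close> are extended to constant (hence commuting) vector fields.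
  On coordinate vectors, \<open>christoffel g p X Y\<close> has the Christoffel symbols as components.\<close>

definition koszul :: "'a::euclidean_space tensor2 \<Rightarrow> 'a \<Rightarrow> 'a \<Rightarrow> 'a \<Rightarrow> 'a \<Rightarrow> real" where
  "koszul g p X Y Z =
     (frechet_derivative (\<lambda>q. g q Y Z) (at p) X
      + frechet_derivative (\<lambda>q. g q X Z) (at p) Y
      - frechet_derivative (\<lambda>q. g q X Y) (at p) Z) / 2"

definition christoffel :: "'a::euclidean_space tensor2 \<Rightarrow> 'a \<Rightarrow> 'a \<Rightarrow> 'a \<Rightarrow> 'a" where
  "christoffel g p X Y = (THE W. \<forall>Z. g p W Z = koszul g p X Y Z)"

lemma smooth_map_differentiable: "smooth_map f \<Longrightarrow> f differentiable at x"
  unfolding smooth_map_def by (metis differentiable_class.simps(2))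

lemma linear_koszul:
  assumes "riemannian_metric g"
  shows "linear (koszul g p X Y)"
proof -
  have bil: "bilinear (g q)" for q
    using assms by (simp add: riemannian_metric_def)
  have diff: "(\<lambda>q. g q A B) differentiable at p" for A B
    using assms by (simp add: riemannian_metric_def smooth_map_differentiable)
  have D: "((\<lambda>q. g q A B) has_derivative frechet_derivative (\<lambda>q. g q A B) (at p)) (at p)" for A B
    using diff[of A B] by (rule frechet_derivative_works[THEN iffD1])
  have add: "frechet_derivative (\<lambda>q. g q A (B + C)) (at p) V =
      frechet_derivative (\<lambda>q. g q A B) (at p) V + frechet_derivative (\<lambda>q. g q A C) (at p) V" for A B C V
  proof -
    have "((\<lambda>q. g q A (B + C)) has_derivative
        (\<lambda>V. frechet_derivative (\<lambda>q. g q A B) (at p) V + frechet_derivative (\<lambda>q. g q A C) (at p) V)) (at p)"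
      using has_derivative_add[OF D D] bilinear_radd[OF bil] by simp
    from fun_cong[OF frechet_derivative_at[OF this], of V] show ?thesis
      by (rule sym)
  qed
  have scale: "frechet_derivative (\<lambda>q. g q A (c *\<^sub>R B)) (at p) V =
      c * frechet_derivative (\<lambda>q. g q A B) (at p) V" for A B c V
  proof -
    have "((\<lambda>q. g q A (c *\<^sub>R B)) has_derivative
        (\<lambda>V. c * frechet_derivative (\<lambda>q. g q A B) (at p) V)) (at p)"
      using has_derivative_mult_right[OF D, of c] bilinear_rmul[OF bil] by simp
    from fun_cong[OF frechet_derivative_at[OF this], of V] show ?thesis
      by (rule sym)
  qed
  have lin: "linear (frechet_derivative (\<lambda>q. g q X Y) (at p))"
    using D has_derivative_linear by blast
  show ?thesis
    by (rule linearI)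
       (simp_all add: koszul_def add scale linear_add[OF lin] linear_cmul[OF lin] field_simps)
qed

lemma christoffel_unique_existence:
  assumes "riemannian_metric g"
  shows "\<exists>!W. \<forall>Z. g p W Z = koszul g p X Y Z"
proof -
  have bil: "bilinear (g p)" and pos: "\<And>V. V \<noteq> 0 \<Longrightarrow> g p V V > 0"
    using assms by (auto simp: riemannian_metric_def)
  have nondeg: "W = W'" if "\<And>Z. g p W Z = g p W' Z" for W W'
  proof (rule ccontr)
    assume "W \<noteq> W'"
    then have "g p (W - W') (W - W') > 0"
      by (intro pos) simp
    then show False
      using that[of "W - W'"] bilinear_lsub[OF bil, of W W' "W - W'"] by simp
  qed
  define L where "L W = (\<Sum>b\<in>Basis. g p W b *\<^sub>R b)" for W
  have linl: "linear (\<lambda>W. g p W Z)" and linr: "linear (g p W)" for W Z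
    using bil by (auto simp: bilinear_def)
  have "linear L"
    by (rule linearI)
       (simp_all add: L_def linear_add[OF linl] linear_cmul[OF linl] scaleR_add_left
         sum.distrib scaleR_sum_right)
  have Lb: "L W \<bullet> b = g p W b" if "b \<in> Basis" for W b
    using that by (simp add: L_def)
  have ext: "F = G" if "linear F" "linear G" "\<And>b. b \<in> Basis \<Longrightarrow> F b = G b" for F G :: "'a \<Rightarrow> real"
    using that by (rule linear_eq_stdbasis)
  have "inj L"
  proof (rule injI)
    fix W W' assume "L W = L W'"
    then have "g p W b = g p W' b" if "b \<in> Basis" for b
      using Lb that by metis
    then have "g p W = g p W'"
      by (rule ext[OF linr linr])
    then show "W = W'"
      using nondeg by simp
  qed
  then have "surj L"
    using \<open>linear L\<close> linear_injective_imp_surjective by blast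
  then obtain W where W: "L W = (\<Sum>b\<in>Basis. koszul g p X Y b *\<^sub>R b)"
    by (metis surjD)
  have "g p W b = koszul g p X Y b" if "b \<in> Basis" for b
    using Lb[OF that, of W] that by (simp add: W)
  then have "g p W = koszul g p X Y"
    by (rule ext[OF linr linear_koszul[OF assms]])
  then have W: "g p W Z = koszul g p X Y Z" for Z
    by simp
  show ?thesis
  proof (rule ex1I[of _ W])
    show "\<forall>Z. g p W Z = koszul g p X Y Z"
      using W by blast
    show "W' = W" if "\<forall>Z. g p W' Z = koszul g p X Y Z" for W'
      using that W by (intro nondeg) simp
  qed
qed

lemma christoffel:
  assumes "riemannian_metric g"
  shows "g p (christoffel g p X Y) Z = koszul g p X Y Z"
  using theI'[OF christoffel_unique_existence[OF assms]] unfolding christoffel_def by blast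

text \<open>The geodesic equation \<open>\<nabla>\<^bsub>\<gamma>'\<^esub> \<gamma>' = \<gamma>'' + \<Gamma>(\<gamma>', \<gamma>') = 0\<close>.\<close>

definition geodesic_on :: "'a::euclidean_space tensor2 \<Rightarrow> real set \<Rightarrow> (real \<Rightarrow> 'a) \<Rightarrow> bool" where
  "geodesic_on g I \<gamma> \<longleftrightarrow>
     (\<exists>\<gamma>'. \<forall>t\<in>I. (\<gamma> has_vector_derivative \<gamma>' t) (at t) \<and>
        (\<gamma>' has_vector_derivative - christoffel g (\<gamma> t) (\<gamma>' t) (\<gamma>' t)) (at t))"

definition geodesically_complete :: "'a::euclidean_space tensor2 \<Rightarrow> bool" where
  "geodesically_complete g \<longleftrightarrow>
     (\<forall>I \<gamma>. open I \<and> is_interval I \<and> I \<noteq> {} \<and> geodesic_on g I \<gamma> \<longrightarrow>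
        (\<exists>\<delta>. geodesic_on g UNIV \<delta> \<and> (\<forall>t\<in>I. \<delta> t = \<gamma> t)))"

definition lie_bracket :: "('a::euclidean_space \<Rightarrow> 'a) \<Rightarrow> ('a \<Rightarrow> 'a) \<Rightarrow> 'a \<Rightarrow> 'a" where
  "lie_bracket X Y p = frechet_derivative Y (at p) (X p) - frechet_derivative X (at p) (Y p)"

definition lie_derivative ::
    "('a::euclidean_space \<Rightarrow> 'a) \<Rightarrow> 'a tensor2 \<Rightarrow> ('a \<Rightarrow> 'a) \<Rightarrow> ('a \<Rightarrow> 'a) \<Rightarrow> 'a \<Rightarrow> real" where
  "lie_derivative X g Y Z p =
     frechet_derivative (\<lambda>q. g q (Y q) (Z q)) (at p) (X p)
     - g p (lie_bracket X Y p) (Z p) - g p (Y p) (lie_bracket X Z p)"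

definition killing_field :: "'a::euclidean_space tensor2 \<Rightarrow> ('a \<Rightarrow> 'a) \<Rightarrow> bool" where
  "killing_field g X \<longleftrightarrow> smooth_map X \<and>
     (\<forall>Y Z p. smooth_map Y \<and> smooth_map Z \<longrightarrow> lie_derivative X g Y Z p = 0)"

definition constant_length :: "'a::euclidean_space tensor2 \<Rightarrow> ('a \<Rightarrow> 'a) \<Rightarrow> bool" where
  "constant_length g X \<longleftrightarrow> (\<exists>c. \<forall>p. sqrt (g p (X p) (X p)) = c)"

text \<open>Points of \<open>\<real>\<^sup>n\<close> are triples \<open>(v, u, x)\<close> with \<open>x = (x\<^sup>3, \<dots>, x\<^sup>n)\<close> in \<open>real ^ 'm\<close>. Since
  \<open>CARD('m) = n - 2\<close> and index types are nonempty, \<open>'m\<close> ranges exactly over the dimensions \<open>n \<ge> 3\<close>.\<close>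

type_synonym 'm spacetime = "real \<times> real \<times> (real ^ 'm)"

lemma DIM_spacetime:
  "DIM('m::finite spacetime) = CARD('m) + 2" "DIM('m spacetime) \<ge> 3"
  by (simp_all add: Suc_le_eq)

definition dv :: "'m::finite spacetime \<Rightarrow> real" where
  "dv X = fst X"

definition du :: "'m::finite spacetime \<Rightarrow> real" where
  "du X = fst (snd X)"

definition dx :: "'m::finite \<Rightarrow> 'm spacetime \<Rightarrow> real" where
  "dx i X = snd (snd X) $ i"

definition partial_v :: "'m::finite spacetime \<Rightarrow> 'm spacetime" where
  "partial_v p = (1, 0, 0)"

definition partial_u :: "'m::finite spacetime \<Rightarrow> 'm spacetime" where
  "partial_u p = (0, 1, 0)"

text \<open>Here \<open>dv du\<close> denotes the symmetric product \<open>(dv \<otimes> du + du \<otimes> dv) / 2\<close>.\<close>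

definition pp_wave :: "('m::finite spacetime \<Rightarrow> real) \<Rightarrow> 'm spacetime tensor2" where
  "pp_wave H p X Y =
     H p * du X * du Y + 2 * ((dv X * du Y + du X * dv Y) / 2) + (\<Sum>i\<in>UNIV. dx i X * dx i Y)"

definition T_field :: "('m::finite spacetime \<Rightarrow> real) \<Rightarrow> 'm spacetime \<Rightarrow> 'm spacetime" where
  "T_field H p = (1/2 * (H p + 1)) *\<^sub>R partial_v p - partial_u p"

definition flat :: "'a::euclidean_space tensor2 \<Rightarrow> ('a \<Rightarrow> 'a) \<Rightarrow> 'a \<Rightarrow> 'a \<Rightarrow> real" where
  "flat h T p X = h p (T p) X"

definition riemannian_dual :: "'a::euclidean_space tensor2 \<Rightarrow> ('a \<Rightarrow> 'a) \<Rightarrow> 'a tensor2" where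
  "riemannian_dual h T p X Y = h p X Y + 2 * (flat h T p X * flat h T p Y)"

lemma pp_wave_frame:
  "pp_wave H p (partial_v p) (partial_u p) = 1"
  "pp_wave H p (partial_u p) (partial_u p) = H p"
  "pp_wave H p (partial_v p) (partial_v p) = 0"
  "pp_wave H p (T_field H p) (T_field H p) = -1"
  by (simp_all add: pp_wave_def T_field_def partial_v_def partial_u_def dv_def du_def dx_def
      field_simps)

end

theory Submission
  imports Defs
begin

text \<open>With \<open>\<theta> = dv + (H/2) du\<close> the dual metric is \<open>g = 2 \<theta>\<^sup>2 + du\<^sup>2/2 + |dx|\<^sup>2\<close>, a Kaluza--Klein
  metric over a flat base on which \<open>\<partial>\<^sub>v\<close> acts by translation. Along a geodesic \<open>\<theta>(\<gamma>')\<close> and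
  \<open>u'\<^sup>2/2 + |x'|\<^sup>2\<close> are constant, so \<open>(u, x)\<close> stays in a compact set over bounded time intervals; as
  \<open>H\<close> does not depend on \<open>v\<close>, it is bounded there, and \<open>v' = \<theta>(\<gamma>') - (H/2) u'\<close> is bounded too. Hence
  no solution of the geodesic equation leaves every compact set in finite time.\<close>

section \<open>Smooth maps\<close>

text \<open>The classes decrease with \<open>k\<close> because differentiability gives continuity at
  the bottom. The product rule needs this: it leaves one factor undifferentiated.\<close>

lemma differentiable_class_Suc_imp:
  "differentiable_class (Suc k) f \<Longrightarrow> differentiable_class k f"
proof (induction k arbitrary: f)
  case 0
  then show ?case
    by (auto intro!: continuous_at_imp_continuous_on differentiable_imp_continuous_within)
next
  case (Suc k)
  from Suc.prems have "\<forall>x. f differentiable at x"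
    and "\<forall>w. differentiable_class (Suc k) (\<lambda>x. frechet_derivative f (at x) w)"
    unfolding differentiable_class.simps(2)[of "Suc k"] by blast+
  with Suc.IH show ?case
    by (simp only: differentiable_class.simps(2)[of k]) simp
qed

text \<open>Derivatives are unique, so an explicit formula may replace
  \<open>frechet_derivative\<close>. All closure properties below go through this rule by induction
  on \<open>k\<close>.\<close>

lemma differentiable_class_SucI:
  assumes "\<And>x. (f has_derivative f' x) (at x)" "\<And>w. differentiable_class k (\<lambda>x. f' x w)"
  shows "differentiable_class (Suc k) f"
proof -
  have "frechet_derivative f (at x) = f' x" for x
    using frechet_derivative_at[OF assms(1)] by simp
  then show ?thesis
    using assms by (auto simp: differentiable_def)
qed

lemma differentiable_class_has_derivative:
  "differentiable_class (Suc k) f \<Longrightarrow> (f has_derivative frechet_derivative f (at x)) (at x)"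
  by (simp flip: frechet_derivative_works)

lemma differentiable_class_const: "differentiable_class k (\<lambda>x. c)"
  by (induction k arbitrary: c) (auto intro!: differentiable_class_SucI[where f' = "\<lambda>x w. 0"] simp del: differentiable_class.simps(2))

lemma differentiable_class_add:
  assumes "differentiable_class k f" "differentiable_class k g"
  shows "differentiable_class k (\<lambda>x. f x + g x)"
  using assms
proof (induction k arbitrary: f g)
  case 0
  then show ?case
    by (auto intro: continuous_intros)
next
  case (Suc k)
  then show ?case
    by (intro differentiable_class_SucI[OF has_derivative_add[OF
            differentiable_class_has_derivative differentiable_class_has_derivative]] Suc.IH) auto
qed

lemma differentiable_class_linear_image:
  assumes "differentiable_class k f" "bounded_linear L"
  shows "differentiable_class k (\<lambda>x. L (f x))"
  using assms
proof (induction k arbitrary: f)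
  case 0
  then show ?case
    by (auto intro: bounded_linear.continuous_on)
next
  case (Suc k)
  show ?case
  proof (rule differentiable_class_SucI)
    show "((\<lambda>x. L (f x)) has_derivative (\<lambda>w. L (frechet_derivative f (at x) w))) (at x)" for x
      by (rule bounded_linear.has_derivative[OF Suc.prems(2)
            differentiable_class_has_derivative[OF Suc.prems(1)]])
    show "differentiable_class k (\<lambda>x. L (frechet_derivative f (at x) w))" for w
      using Suc.prems by (intro Suc.IH) simp_all
  qed
qed

lemma differentiable_class_linear_preimage:
  assumes "differentiable_class k f" "bounded_linear L"
  shows "differentiable_class k (\<lambda>x. f (L x))"
  using assms
proof (induction k arbitrary: f)
  case 0
  then show ?case
    using continuous_on_compose2[of UNIV f UNIV L] linear_continuous_on[of L UNIV] by simp
next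
  case (Suc k)
  show ?case
  proof (rule differentiable_class_SucI)
    show "((\<lambda>x. f (L x)) has_derivative (\<lambda>w. frechet_derivative f (at (L x)) (L w))) (at x)" for x
      by (rule has_derivative_compose[OF bounded_linear_imp_has_derivative[OF Suc.prems(2)]
            differentiable_class_has_derivative[OF Suc.prems(1)]])
    \<comment> \<open>The direction \<open>L w\<close> does not vary with \<open>x\<close>, so this
      is again a function of class \<open>k\<close> composed with \<open>L\<close>.\<close>
    show "differentiable_class k (\<lambda>x. frechet_derivative f (at (L x)) (L w))" for w
      using Suc.prems Suc.IH[of "\<lambda>y. frechet_derivative f (at y) (L w)"] by simp
  qed
qed

lemma differentiable_class_bilinear:
  assumes "differentiable_class k f" "differentiable_class k g" "bounded_bilinear B"
  shows "differentiable_class k (\<lambda>x. B (f x) (g x))"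
  using assms
proof (induction k arbitrary: f g)
  case 0
  then show ?case
    by (auto intro: bounded_bilinear.continuous_on)
next
  case (Suc k)
  show ?case
  proof (rule differentiable_class_SucI)
    show "((\<lambda>x. B (f x) (g x)) has_derivative
        (\<lambda>w. B (f x) (frechet_derivative g (at x) w) + B (frechet_derivative f (at x) w) (g x))) (at x)" for x
      using Suc.prems
      by (intro bounded_bilinear.FDERIV differentiable_class_has_derivative[of k]) auto
    show "differentiable_class k
        (\<lambda>x. B (f x) (frechet_derivative g (at x) w) + B (frechet_derivative f (at x) w) (g x))" for w
      using Suc.prems
      by (intro differentiable_class_add Suc.IH differentiable_class_Suc_imp[of k f]
          differentiable_class_Suc_imp[of k g]) auto
  qed
qed

lemma smooth_map_const: "smooth_map (\<lambda>x. c)"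
  by (simp add: smooth_map_def differentiable_class_const)

lemma smooth_map_add: "smooth_map f \<Longrightarrow> smooth_map g \<Longrightarrow> smooth_map (\<lambda>x. f x + g x)"
  by (simp add: smooth_map_def differentiable_class_add)

lemma smooth_map_linear_image: "bounded_linear L \<Longrightarrow> smooth_map f \<Longrightarrow> smooth_map (\<lambda>x. L (f x))"
  by (simp add: smooth_map_def differentiable_class_linear_image)

lemma smooth_map_linear_preimage: "bounded_linear L \<Longrightarrow> smooth_map f \<Longrightarrow> smooth_map (\<lambda>x. f (L x))"
  by (simp add: smooth_map_def differentiable_class_linear_preimage)

lemma smooth_map_bilinear:
  "bounded_bilinear B \<Longrightarrow> smooth_map f \<Longrightarrow> smooth_map g \<Longrightarrow> smooth_map (\<lambda>x. B (f x) (g x))"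
  by (simp add: smooth_map_def differentiable_class_bilinear)

lemma smooth_map_linear:
  assumes "bounded_linear L"
  shows "smooth_map L"
  unfolding smooth_map_def
proof
  fix k
  show "differentiable_class k L"
  proof (cases k)
    case 0
    then show ?thesis
      using assms by (simp add: linear_continuous_on)
  next
    case (Suc j)
    then show ?thesis
      using assms by (auto intro!: differentiable_class_SucI[where f' = "\<lambda>x. L"]
          bounded_linear_imp_has_derivative differentiable_class_const simp del: differentiable_class.simps)
  qed
qed

lemma smooth_map_sum:
  "finite A \<Longrightarrow> (\<And>i. i \<in> A \<Longrightarrow> smooth_map (f i)) \<Longrightarrow> smooth_map (\<lambda>x. \<Sum>i\<in>A. f i x)"
  by (induction A rule: finite_induct) (auto intro: smooth_map_const smooth_map_add)

lemma smooth_map_Pair: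
  assumes "smooth_map f" "smooth_map g"
  shows "smooth_map (\<lambda>x. (f x, g x))"
proof -
  have "bounded_linear (\<lambda>a. (a, 0))" "bounded_linear (\<lambda>b. (0, b))"
    by (intro bounded_linear_Pair bounded_linear_ident bounded_linear_zero)+
  \<comment> \<open>A pair is a sum of two linear embeddings, so no further induction on
    \<open>k\<close> is required.\<close>
  then have "smooth_map (\<lambda>x. (f x, 0) + (0, g x))"
    using assms by (intro smooth_map_add) (rule smooth_map_linear_image; simp)+
  then show ?thesis
    by simp
qed

lemma smooth_map_frechet_derivative: "smooth_map f \<Longrightarrow> smooth_map (\<lambda>x. frechet_derivative f (at x) w)"
  unfolding smooth_map_def by (metis differentiable_class.simps(2))

lemma smooth_map_continuous_on: "smooth_map f \<Longrightarrow> continuous_on S f"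
  unfolding smooth_map_def by (metis continuous_on_subset differentiable_class.simps(1) subset_UNIV)

lemma smooth_map_has_derivative:
  "smooth_map f \<Longrightarrow> (f has_derivative frechet_derivative f (at x)) (at x)"
  using smooth_map_differentiable frechet_derivative_works by blast

lemmas smooth_intros = smooth_map_const smooth_map_add smooth_map_Pair
  smooth_map_linear[OF bounded_linear_ident]
  smooth_map_bilinear[OF bounded_bilinear_mult] smooth_map_bilinear[OF bounded_bilinear_scaleR]
  smooth_map_bilinear[OF bounded_bilinear_inner]
  smooth_map_linear_image[OF bounded_linear_fst] smooth_map_linear_image[OF bounded_linear_snd]
  smooth_map_linear_image[OF bounded_linear_minus[OF bounded_linear_ident]]

section \<open>Local Lipschitz bounds and invariant directions\<close>

text \<open>The partial derivatives are continuous, hence bounded on the compact ball; the ball is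
  convex, so the mean value inequality applies.\<close>

lemma smooth_map_lipschitz_cball:
  fixes f :: "'a::euclidean_space \<Rightarrow> 'b::real_normed_vector"
  assumes "smooth_map f"
  shows "\<exists>L. L-lipschitz_on (cball c r) f"
proof -
  define D where "D x = frechet_derivative f (at x)" for x
  have D: "(f has_derivative D x) (at x)" for x
    unfolding D_def using assms by (rule smooth_map_has_derivative)
  have "\<exists>M. \<forall>x\<in>cball c r. norm (D x b) \<le> M" for b
  proof -
    have "compact ((\<lambda>x. D x b) ` cball c r)"
      unfolding D_def using assms
      by (intro compact_continuous_image smooth_map_continuous_on smooth_map_frechet_derivative) auto
    then show ?thesis
      by (auto dest!: compact_imp_bounded simp: bounded_iff)
  qed
  then have "\<exists>M. \<forall>b. \<forall>x\<in>cball c r. norm (D x b) \<le> M b"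
    by (rule choice[OF allI])
  then obtain M where M: "\<And>b x. x \<in> cball c r \<Longrightarrow> norm (D x b) \<le> M b"
    by blast
  \<comment> \<open>A Lipschitz constant must be nonnegative; for \<open>r < 0\<close> the ball is
    empty and the bounds \<open>M b\<close> may be negative, hence \<open>max 0\<close>.\<close>
  have "onorm (D x) \<le> max 0 (\<Sum>b\<in>Basis. M b)" if x: "x \<in> cball c r" for x
  proof (rule onorm_le)
    fix w
    have lin: "linear (D x)"
      using D has_derivative_linear by blast
    have "D x w = (\<Sum>b\<in>Basis. (w \<bullet> b) *\<^sub>R D x b)"
      by (subst euclidean_representation[of w, symmetric])
         (simp add: linear_sum[OF lin] linear_cmul[OF lin])
    also have "norm \<dots> \<le> (\<Sum>b\<in>Basis. norm w * M b)"
      by (intro sum_norm_le) (simp add: Basis_le_norm M[OF x] mult_mono)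
    also have "\<dots> \<le> max 0 (\<Sum>b\<in>Basis. M b) * norm w"
      by (simp add: mult.commute[of _ "norm w"] mult_left_mono flip: sum_distrib_left)
    finally show "norm (D x w) \<le> max 0 (\<Sum>b\<in>Basis. M b) * norm w" .
  qed
  then have "(max 0 (\<Sum>b\<in>Basis. M b))-lipschitz_on (cball c r) f"
    by (intro bounded_derivative_imp_lipschitz[of _ f D])
       (auto intro: has_derivative_at_withinI[OF D])
  then show ?thesis
    by blast
qed

lemma frechet_derivative_invariant_direction:
  assumes "f differentiable at p" and inv: "\<And>t. f (p + t *\<^sub>R e) = f p"
  shows "frechet_derivative f (at p) e = 0"
proof -
  \<comment> \<open>Writing \<open>p\<close> as the value at time 0 of the line through
    \<open>p\<close> in direction \<open>e\<close> puts the chain rule in the form used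
    next.\<close>
  have "(f has_derivative frechet_derivative f (at p)) (at (p + 0 *\<^sub>R e))"
    using assms(1) by (simp flip: frechet_derivative_works)
  then have "((\<lambda>t. f (p + t *\<^sub>R e)) has_derivative (\<lambda>t. frechet_derivative f (at p) (t *\<^sub>R e))) (at (0::real))"
    by (rule has_derivative_compose[rotated]) (auto intro!: derivative_eq_intros)
  moreover have "((\<lambda>t. f (p + t *\<^sub>R e)) has_derivative (\<lambda>t. 0)) (at (0::real))"
    by (simp add: inv)
  ultimately have "(\<lambda>t. frechet_derivative f (at p) (t *\<^sub>R e)) = (\<lambda>t. 0)"
    by (rule has_derivative_unique)
  from fun_cong[OF this, of 1] show ?thesis
    by simp
qed

section \<open>Ordinary differential equations\<close>

text \<open>This is the oriented integral from 0 to \<open>t\<close> for either sign of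
  \<open>t\<close>: one of the two intervals is empty or a point.\<close>

definition primitive :: "(real \<Rightarrow> 'a::banach) \<Rightarrow> real \<Rightarrow> 'a" where
  "primitive f t = integral {0..t} f - integral {t..0} f"

lemma primitive_has_vector_derivative:
  fixes f :: "real \<Rightarrow> 'a::banach"
  assumes "continuous_on UNIV f"
  shows "(primitive f has_vector_derivative f t) (at t)"
proof -
  \<comment> \<open>Both 0 and \<open>t\<close> lie inside \<open>{-N..N}\<close>, and there the
    integral from \<open>-N\<close> differs from \<open>primitive f\<close> by a constant.\<close>
  define N where "N = \<bar>t\<bar> + 1"
  have cont: "continuous_on S f" for S
    using assms continuous_on_subset by blast
  have int: "f integrable_on {a..b}" for a b
    by (rule integrable_continuous_real[OF cont])
  have "((\<lambda>u. integral {-N..u} f) has_vector_derivative f t) (at t within {-N..N})"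
    by (rule integral_has_vector_derivative[OF cont]) (auto simp: N_def)
  then have "((\<lambda>u. integral {-N..u} f) has_vector_derivative f t) (at t)"
    by (subst (asm) at_within_interior) (auto simp: N_def)
  then have "((\<lambda>u. integral {-N..u} f - integral {-N..0} f) has_vector_derivative f t) (at t)"
    by (auto intro: derivative_eq_intros)
  then show ?thesis
  proof (rule has_vector_derivative_transform_within_open)
    show "open {-N<..<N}" "t \<in> {-N<..<N}"
      by (auto simp: N_def)
    show "integral {-N..u} f - integral {-N..0} f = primitive f u" if "u \<in> {-N<..<N}" for u
    proof (cases "0 \<le> u")
      case True
      then have "integral {-N..0} f + integral {0..u} f = integral {-N..u} f"
        by (intro Henstock_Kurzweil_Integration.integral_combine int) (auto simp: N_def)
      moreover have "integral {u..0} f = 0"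
        using True by (cases "u = 0") auto
      ultimately show ?thesis
        by (simp add: primitive_def algebra_simps)
    next
      case False
      then have "integral {-N..u} f + integral {u..0} f = integral {-N..0} f"
        using that by (intro Henstock_Kurzweil_Integration.integral_combine int) auto
      then show ?thesis
        using False by (simp add: primitive_def algebra_simps)
    qed
  qed
qed

lemma primitive_0 [simp]: "primitive f 0 = 0"
  by (simp add: primitive_def)

lemma primitive_diff:
  fixes f g :: "real \<Rightarrow> 'a::banach"
  assumes "continuous_on UNIV f" "continuous_on UNIV g"
  shows "primitive f t - primitive g t = primitive (\<lambda>s. f s - g s) t"
proof -
  have "f integrable_on {a..b}" "g integrable_on {a..b}" for a b
    using assms continuous_on_subset by (blast intro: integrable_continuous_real)+
  then show ?thesis
    by (simp add: primitive_def integral_diff)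
qed

text \<open>Integrating the weight \<open>exp (K * \<bar>s\<bar>)\<close> gains a factor
  \<open>1 / K\<close>, which is what makes the Picard operator contract for large
  \<open>K\<close>.\<close>

lemma norm_primitive_le_exp:
  fixes f :: "real \<Rightarrow> 'a::banach"
  assumes cont: "continuous_on UNIV f" and "K > 0" "M \<ge> 0"
    and le: "\<And>s. norm (f s) \<le> M * exp (K * \<bar>s\<bar>)"
  shows "norm (primitive f t) \<le> M / K * exp (K * \<bar>t\<bar>)"
proof -
  have int: "f integrable_on {a..b}" for a b
    using cont continuous_on_subset by (blast intro: integrable_continuous_real)
  show ?thesis
  proof (cases "0 \<le> t")
    case True
    have "((\<lambda>s. M * exp (K * s)) has_integral M / K * exp (K * t) - M / K * exp (K * 0)) {0..t}"
      using \<open>K > 0\<close> True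
      by (intro fundamental_theorem_of_calculus)
         (auto intro!: derivative_eq_intros simp: has_real_derivative_iff_has_vector_derivative[symmetric])
    moreover have "norm (f s) \<le> M * exp (K * s)" if "s \<in> {0..t}" for s
      using le[of s] that by simp
    ultimately have "norm (integral {0..t} f) \<le> M / K * exp (K * t) - M / K * exp (K * 0)"
      by (intro integral_norm_bound_integral[OF int, THEN order_trans] order.refl)
        (auto simp: has_integral_integrable_integral)
    moreover have "integral {t..0} f = 0"
      using True by (cases "t = 0") auto
    ultimately show ?thesis
      using True assms by (simp add: primitive_def) (smt (verit) divide_nonneg_pos)
  next
    case False
    have "((\<lambda>s. M * exp (- K * s)) has_integral - M / K * exp (- K * 0) - (- M / K * exp (- K * t))) {t..0}"
      using \<open>K > 0\<close> False
      by (intro fundamental_theorem_of_calculus)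
         (auto intro!: derivative_eq_intros simp: has_real_derivative_iff_has_vector_derivative[symmetric])
    moreover have "norm (f s) \<le> M * exp (- K * s)" if "s \<in> {t..0}" for s
      using le[of s] that by simp
    ultimately have "norm (integral {t..0} f) \<le> - M / K * exp (- K * 0) - (- M / K * exp (- K * t))"
      by (intro integral_norm_bound_integral[OF int, THEN order_trans] order.refl)
        (auto simp: has_integral_integrable_integral)
    then show ?thesis
      using False assms by (simp add: primitive_def) (smt (verit) divide_nonneg_pos)
  qed
qed

section \<open>Autonomous equations with globally Lipschitz right-hand side\<close>

text \<open>The derivative is two-sided even at an endpoint of a closed \<open>I\<close>, as in
  \<open>geodesic_on\<close>, so restriction to subsets is immediate.\<close>

definition solves_on :: "('a::real_normed_vector \<Rightarrow> 'a) \<Rightarrow> real set \<Rightarrow> (real \<Rightarrow> 'a) \<Rightarrow> bool" where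
  "solves_on F I Y \<longleftrightarrow> (\<forall>t\<in>I. (Y has_vector_derivative F (Y t)) (at t))"

lemma solves_on_subset: "solves_on F I Y \<Longrightarrow> J \<subseteq> I \<Longrightarrow> solves_on F J Y"
  by (auto simp: solves_on_def)

lemma solves_on_continuous: "solves_on F I Y \<Longrightarrow> continuous_on I Y"
  unfolding solves_on_def
  by (meson continuous_at_imp_continuous_on has_vector_derivative_continuous)

text \<open>Picard iteration for \<open>Y t = y0 + exp (K \<bar>t\<bar>) \<phi> t\<close> with \<open>\<phi>\<close> bounded: the weight makes
  the integral operator a contraction on all of \<open>\<real>\<close> at once.\<close>

lemma lipschitz_solves_on_UNIV:
  fixes F :: "'a::banach \<Rightarrow> 'a"
  assumes "L-lipschitz_on UNIV F"
  shows "\<exists>Y. Y 0 = y0 \<and> solves_on F UNIV Y"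
proof -
  have "L \<ge> 0"
    using assms by (rule lipschitz_on_nonneg)
  have F_lip: "norm (F x - F y) \<le> L * norm (x - y)" for x y
    using lipschitz_on_normD[OF assms] by simp
  \<comment> \<open>This gives \<open>L / K < 1\<close>, and \<open>K > 0\<close> also when
    \<open>L = 0\<close>.\<close>
  define K where "K = 2 * L + 1"
  then have "K > 0" using \<open>L \<ge> 0\<close> by simp
  define f where "f \<phi> s = F (y0 + exp (K * \<bar>s\<bar>) *\<^sub>R apply_bcontfun \<phi> s)" for \<phi> s
  have F_cont: "continuous_on UNIV F"
    using assms by (rule lipschitz_on_continuous_on)
  have f_cont: "continuous_on UNIV (f \<phi>)" for \<phi>
    unfolding f_def by (intro continuous_on_compose2[OF F_cont] continuous_intros) auto
  define P where "P \<phi> t = exp (- K * \<bar>t\<bar>) *\<^sub>R primitive (f \<phi>) t" for \<phi> t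
  have cancel: "exp (- K * \<bar>t\<bar>) * (c * exp (K * \<bar>t\<bar>)) = c" for c t
    by (simp add: exp_minus)
  \<comment> \<open>The fixed point theorem works on a complete type, so \<open>P \<phi>\<close>
    must be bounded and continuous. The bound comes from the linear growth of \<open>F\<close>
    around \<open>y0\<close>.\<close>
  have "P \<phi> \<in> bcontfun" for \<phi>
  proof (rule bcontfun_normI)
    have "continuous_on UNIV (primitive (f \<phi>))"
      using primitive_has_vector_derivative[OF f_cont]
      by (meson continuous_at_imp_continuous_on has_vector_derivative_continuous)
    then show "continuous_on UNIV (P \<phi>)"
      unfolding P_def by (intro continuous_intros)
    define M where "M = norm (F y0) + L * norm \<phi>"
    have "M \<ge> 0"
      using \<open>L \<ge> 0\<close> by (simp add: M_def)
    have "norm (f \<phi> s) \<le> M * exp (K * \<bar>s\<bar>)" for s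
    proof -
      have "norm (f \<phi> s) \<le> norm (F y0) + norm (f \<phi> s - F y0)"
        by (metis add.commute diff_add_cancel norm_triangle_ineq)
      also have "\<dots> \<le> norm (F y0) + L * (exp (K * \<bar>s\<bar>) * norm (apply_bcontfun \<phi> s))"
        using F_lip[of "y0 + exp (K * \<bar>s\<bar>) *\<^sub>R apply_bcontfun \<phi> s" y0] by (simp add: f_def)
      also have "\<dots> \<le> norm (F y0) * exp (K * \<bar>s\<bar>) + L * (exp (K * \<bar>s\<bar>) * norm \<phi>)"
        using \<open>L \<ge> 0\<close> \<open>K > 0\<close> norm_bounded[of \<phi> s] mult_left_mono[of 1 "exp (K * \<bar>s\<bar>)" "norm (F y0)"]
        by (intro add_mono mult_left_mono) auto
      finally show ?thesis
        by (simp add: M_def algebra_simps)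
    qed
    from norm_primitive_le_exp[OF f_cont \<open>K > 0\<close> \<open>M \<ge> 0\<close> this]
    have "norm (P \<phi> t) \<le> exp (- K * \<bar>t\<bar>) * (M / K * exp (K * \<bar>t\<bar>))" for t
      unfolding P_def norm_scaleR abs_exp_cancel by (intro mult_left_mono) auto
    then show "norm (P \<phi> t) \<le> M / K" for t
      unfolding cancel .
  qed
  then have P: "apply_bcontfun (Bcontfun (P \<phi>)) = P \<phi>" for \<phi>
    by (simp add: Bcontfun_inverse)
  have "dist (Bcontfun (P \<phi>)) (Bcontfun (P \<psi>)) \<le> L / K * dist \<phi> \<psi>" for \<phi> \<psi>
  proof (rule dist_bound)
    fix t
    have "norm (f \<phi> s - f \<psi> s) \<le> L * dist \<phi> \<psi> * exp (K * \<bar>s\<bar>)" for s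
    proof -
      have "norm (f \<phi> s - f \<psi> s) \<le> L * norm (exp (K * \<bar>s\<bar>) *\<^sub>R (apply_bcontfun \<phi> s - apply_bcontfun \<psi> s))"
        using F_lip[of "y0 + exp (K * \<bar>s\<bar>) *\<^sub>R apply_bcontfun \<phi> s" "y0 + exp (K * \<bar>s\<bar>) *\<^sub>R apply_bcontfun \<psi> s"]
        by (simp add: f_def algebra_simps)
      also have "\<dots> \<le> L * (exp (K * \<bar>s\<bar>) * dist \<phi> \<psi>)"
        using \<open>L \<ge> 0\<close> dist_bounded[of \<phi> s \<psi>] by (auto simp: dist_norm intro!: mult_left_mono)
      finally show ?thesis
        by (simp add: algebra_simps)
    qed
    then have "norm (primitive (\<lambda>s. f \<phi> s - f \<psi> s) t) \<le> L * dist \<phi> \<psi> / K * exp (K * \<bar>t\<bar>)"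
      using \<open>L \<ge> 0\<close> \<open>K > 0\<close> f_cont by (intro norm_primitive_le_exp continuous_intros) auto
    then have "norm (primitive (f \<phi>) t - primitive (f \<psi>) t) \<le> L * dist \<phi> \<psi> / K * exp (K * \<bar>t\<bar>)"
      by (simp add: primitive_diff[OF f_cont f_cont])
    then have "dist (P \<phi> t) (P \<psi> t) \<le> exp (- K * \<bar>t\<bar>) * (L * dist \<phi> \<psi> / K * exp (K * \<bar>t\<bar>))"
      unfolding P_def dist_norm scaleR_diff_right[symmetric] norm_scaleR abs_exp_cancel
      by (intro mult_left_mono) auto
    then show "dist (apply_bcontfun (Bcontfun (P \<phi>)) t) (apply_bcontfun (Bcontfun (P \<psi>)) t)
        \<le> L / K * dist \<phi> \<psi>"
      unfolding P cancel by simp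
  qed
  then obtain \<phi> where "Bcontfun (P \<phi>) = \<phi>"
    using banach_fix_type[of "L / K" "\<lambda>\<phi>. Bcontfun (P \<phi>)"] \<open>L \<ge> 0\<close> by (auto simp: K_def)
  \<comment> \<open>Removing the weight turns the fixed point equation into the integral equation of
    the initial value problem.\<close>
  then have "exp (K * \<bar>t\<bar>) *\<^sub>R apply_bcontfun \<phi> t = primitive (f \<phi>) t" for t
    using fun_cong[OF P[of \<phi>], of t] by (simp add: P_def exp_minus)
  then have "f \<phi> t = F (y0 + primitive (f \<phi>) t)" for t
    by (simp add: f_def)
  then have "solves_on F UNIV (\<lambda>t. y0 + primitive (f \<phi>) t)"
    using primitive_has_vector_derivative[OF f_cont, of \<phi>]
    by (auto simp: solves_on_def intro!: derivative_eq_intros)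
  then show ?thesis
    by (intro exI[of _ "\<lambda>t. y0 + primitive (f \<phi>) t"]) simp
qed

section \<open>Uniqueness of solutions\<close>

text \<open>The function \<open>d s * exp (- K * s)\<close> has nonpositive derivative and starts at
  0.\<close>

lemma gronwall_zero:
  fixes d :: "real \<Rightarrow> real"
  assumes "a \<le> b" "\<And>s. a \<le> s \<Longrightarrow> s \<le> b \<Longrightarrow> \<exists>d'. (d has_real_derivative d') (at s) \<and> d' \<le> K * d s"
    and "d a = 0"
  shows "d b \<le> 0"
proof -
  have "d b * exp (- K * b) \<le> d a * exp (- K * a)"
  proof (rule DERIV_nonpos_imp_nonincreasing[OF \<open>a \<le> b\<close>])
    fix s assume "a \<le> s" "s \<le> b"
    then obtain d' where d': "(d has_real_derivative d') (at s)" "d' \<le> K * d s"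
      using assms(2) by blast
    have "((\<lambda>s. d s * exp (- K * s)) has_real_derivative (d' - K * d s) * exp (- K * s)) (at s)"
      by (auto intro!: derivative_eq_intros d'(1) simp: algebra_simps)
    moreover have "(d' - K * d s) * exp (- K * s) \<le> 0"
      using d'(2) by (simp add: mult_nonpos_nonneg)
    ultimately show "\<exists>y. ((\<lambda>s. d s * exp (- K * s)) has_real_derivative y) (at s) \<and> y \<le> 0"
      by blast
  qed
  then show ?thesis
    using \<open>d a = 0\<close> by (simp add: mult_le_0_iff)
qed

text \<open>Time reversal; it reduces uniqueness backwards in time to uniqueness forwards.\<close>

lemma solves_on_reflect:
  assumes "solves_on F I Y"
  shows "solves_on (\<lambda>y. - F y) (uminus ` I) (\<lambda>t. Y (- t))"
proof -
  have "((Y \<circ> uminus) has_vector_derivative (-1) *\<^sub>R F (Y (- t))) (at t)" if "- t \<in> I" for t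
    using assms that
    by (intro vector_diff_chain_at) (auto simp: solves_on_def intro!: derivative_eq_intros)
  moreover have "- t \<in> I" if "t \<in> uminus ` I" for t
    using that by auto
  ultimately show ?thesis
    by (simp add: solves_on_def o_def)
qed

text \<open>Both orbits lie in a common ball, where \<open>F\<close> has some Lipschitz constant
  \<open>L\<close>. By Cauchy-Schwarz the squared distance \<open>d\<close> satisfies
  \<open>d' \<le> 2 * L * d\<close>, so it remains 0.\<close>

lemma solves_on_unique_forward:
  fixes F :: "'a::real_inner \<Rightarrow> 'a"
  assumes lip: "\<And>r. \<exists>L. L-lipschitz_on (cball 0 r) F"
    and Y: "solves_on F {a..b} Y" and Z: "solves_on F {a..b} Z"
    and "a \<le> b" "Y a = Z a"
  shows "Y b = Z b"
proof -
  have "compact (Y ` {a..b} \<union> Z ` {a..b})"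
    using Y Z by (intro compact_Un compact_continuous_image solves_on_continuous) auto
  then obtain r where "\<forall>y \<in> Y ` {a..b} \<union> Z ` {a..b}. norm y \<le> r"
    using compact_imp_bounded bounded_iff by metis
  then have r: "Y t \<in> cball 0 r \<and> Z t \<in> cball 0 r" if "t \<in> {a..b}" for t
    using that by simp
  obtain L where L: "L-lipschitz_on (cball 0 r) F"
    using lip by blast
  define d where "d t = (Y t - Z t) \<bullet> (Y t - Z t)" for t
  have "d b \<le> 0"
  proof (rule gronwall_zero[OF \<open>a \<le> b\<close>])
    show "d a = 0"
      using \<open>Y a = Z a\<close> by (simp add: d_def)
    fix s assume s: "a \<le> s" "s \<le> b"
    have "((\<lambda>t. Y t - Z t) has_vector_derivative F (Y s) - F (Z s)) (at s)"
      using Y Z s by (intro has_vector_derivative_diff) (auto simp: solves_on_def)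
    from bounded_bilinear.has_vector_derivative[OF bounded_bilinear_inner this this]
    have "(d has_vector_derivative 2 * ((F (Y s) - F (Z s)) \<bullet> (Y s - Z s))) (at s)"
      by (simp add: d_def[abs_def] inner_commute)
    moreover have "(F (Y s) - F (Z s)) \<bullet> (Y s - Z s) \<le> L * norm (Y s - Z s) * norm (Y s - Z s)"
      using lipschitz_on_normD[OF L] r s
      by (intro norm_cauchy_schwarz[THEN order_trans] mult_right_mono) auto
    ultimately show "\<exists>d'. (d has_real_derivative d') (at s) \<and> d' \<le> (2 * L) * d s"
      by (intro exI conjI) (auto simp: has_real_derivative_iff_has_vector_derivative d_def
          dot_square_norm power2_eq_square)
  qed
  then show ?thesis
    by (metis d_def eq_iff_diff_eq_0 inner_gt_zero_iff linorder_not_le)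
qed

lemma solves_on_unique:
  fixes F :: "'a::real_inner \<Rightarrow> 'a"
  assumes lip: "\<And>r. \<exists>L. L-lipschitz_on (cball 0 r) F"
    and "is_interval I" "a \<in> I" "t \<in> I"
    and Y: "solves_on F I Y" and Z: "solves_on F I Z" and "Y a = Z a"
  shows "Y t = Z t"
proof (cases "a \<le> t")
  case True
  then have "{a..t} \<subseteq> I"
    using assms by (metis interval_subset_is_interval cbox_interval box_real(2))
  then show ?thesis
    using solves_on_unique_forward[OF lip, of a t Y Z] Y Z True \<open>Y a = Z a\<close> solves_on_subset by blast
next
  case False
  then have "{t..a} \<subseteq> I"
    using assms by (metis interval_subset_is_interval box_real(2))
  then have "{-a..-t} \<subseteq> uminus ` I"
    by (metis image_mono image_uminus_atLeastAtMost)
  moreover have "\<exists>L. L-lipschitz_on (cball 0 r) (\<lambda>y. - F y)" for r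
    using lip by simp
  ultimately show ?thesis
    using solves_on_unique_forward[of "\<lambda>y. - F y" "-a" "-t" "\<lambda>t. Y (-t)" "\<lambda>t. Z (-t)"]
      solves_on_reflect[OF Y] solves_on_reflect[OF Z] False \<open>Y a = Z a\<close>
    by (smt (verit, best) solves_on_subset)
qed

section \<open>Existence from a priori bounds\<close>

text \<open>Composing \<open>F\<close> with the nearest-point projection \<open>c\<close> onto a
  large ball makes it globally Lipschitz. By the a priori bound the resulting solution stays inside
  the ball, where the truncation changes nothing.\<close>

lemma solves_on_bounded_interval:
  fixes F :: "'a::euclidean_space \<Rightarrow> 'a"
  assumes lip: "\<And>r. \<exists>L. L-lipschitz_on (cball 0 r) F" and "N > 0"
    and apriori: "\<And>Y b t. 0 < b \<Longrightarrow> b \<le> N \<Longrightarrow> Y 0 = y0 \<Longrightarrow> solves_on F {-b<..<b} Y \<Longrightarrow>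
        t \<in> {-b<..<b} \<Longrightarrow> norm (Y t) \<le> r"
  shows "\<exists>Y. Y 0 = y0 \<and> solves_on F {-N<..<N} Y"
proof -
  \<comment> \<open>The margin 1 makes the radius strictly larger than both the a priori bound and
    the initial norm.\<close>
  define \<rho> where "\<rho> = max r (norm y0) + 1"
  then have "\<rho> > 0" "r < \<rho>" "norm y0 < \<rho>"
    by (simp_all add: add_nonneg_pos le_max_iff_disj)
  obtain L where L: "L-lipschitz_on (cball 0 \<rho>) F"
    using lip by blast
  define c where "c = closest_point (cball (0::'a) \<rho>)"
  have c_lip: "1-lipschitz_on UNIV c"
    using \<open>\<rho> > 0\<close> unfolding c_def by (intro lipschitz_onI) (auto intro: closest_point_lipschitz)
  moreover have "c ` UNIV \<subseteq> cball 0 \<rho>"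
    using \<open>\<rho> > 0\<close> closest_point_in_set[of "cball (0::'a) \<rho>"] unfolding c_def by force
  ultimately have "(L * 1)-lipschitz_on UNIV (\<lambda>y. F (c y))"
    using L by (intro lipschitz_on_compose2) (auto intro: lipschitz_on_subset)
  then obtain Y where Y: "Y 0 = y0" "solves_on (\<lambda>y. F (c y)) UNIV Y"
    using lipschitz_solves_on_UNIV by blast
  have Y_cont: "continuous_on UNIV Y"
    using Y(2) by (rule solves_on_continuous)
  have solves: "solves_on F {-b<..<b} Y" if "\<And>t. \<bar>t\<bar> < b \<Longrightarrow> norm (Y t) < \<rho>" for b
  proof -
    have "c (Y t) = Y t" if "t \<in> {-b<..<b}" for t
      unfolding c_def using \<open>\<And>t. \<bar>t\<bar> < b \<Longrightarrow> norm (Y t) < \<rho>\<close>[of t] that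
      by (intro closest_point_self) (auto simp: less_imp_le abs_less_iff minus_less_iff)
    then show ?thesis
      using Y(2) unfolding solves_on_def by (metis UNIV_I)
  qed
  have "norm (Y t) < \<rho>" if "\<bar>t\<bar> < N" for t
  proof (rule ccontr)
    \<comment> \<open>The infimum \<open>b\<close> of \<open>S\<close> is the first exit time in
      either time direction. Before it \<open>Y\<close> solves the original equation, so the norm is
      at most \<open>r\<close>, by continuity also at \<open>b\<close> and \<open>-b\<close>; this
      contradicts \<open>r < \<rho>\<close>.\<close>
    define S where "S = {s. 0 \<le> s \<and> (norm (Y s) \<ge> \<rho> \<or> norm (Y (- s)) \<ge> \<rho>)}"
    assume "\<not> norm (Y t) < \<rho>"
    then have t: "\<bar>t\<bar> \<in> S"
      by (auto simp: S_def abs_if)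
    have "closed S"
      unfolding S_def using Y_cont
      by (intro closed_Collect_conj closed_Collect_disj closed_Collect_le continuous_intros
          continuous_on_compose2[OF Y_cont]) auto
    moreover have bdd: "bdd_below S"
      by (auto simp: S_def intro: bdd_belowI[of _ 0])
    ultimately have "Inf S \<in> S"
      using t by (intro closed_contains_Inf) auto
    define b where "b = Inf S"
    have b: "b \<in> S" "b \<noteq> 0"
      using \<open>Inf S \<in> S\<close> Y(1) \<open>norm y0 < \<rho>\<close> by (auto simp: b_def S_def)
    then have "b > 0"
      by (auto simp: S_def)
    have "b \<le> N"
      using cInf_lower[OF t bdd] that by (simp add: b_def)
    have "norm (Y s) < \<rho>" if "\<bar>s\<bar> < b" for s
    proof (rule ccontr)
      assume "\<not> norm (Y s) < \<rho>"
      then have "\<bar>s\<bar> \<in> S"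
        by (auto simp: S_def abs_if)
      then show False
        using cInf_lower[OF _ bdd] that by (fastforce simp: b_def)
    qed
    then have "solves_on F {-b<..<b} Y"
      by (rule solves)
    then have "norm (Y s) \<le> r" if "s \<in> {-b<..<b}" for s
      using apriori[of b Y s] \<open>b > 0\<close> \<open>b \<le> N\<close> Y(1) that by blast
    moreover have "closure {-b<..<b} = {-b..b}"
      using \<open>b > 0\<close> by simp
    ultimately have "norm (Y s) \<le> r" if "s \<in> {-b..b}" for s
      using that continuous_on_closure_norm_le[of "{-b<..<b}" Y r s] Y_cont
      by (metis continuous_on_subset subset_UNIV)
    then have "norm (Y b) \<le> r" "norm (Y (- b)) \<le> r"
      using \<open>b > 0\<close> by auto
    then show False
      using \<open>b \<in> S\<close> \<open>r < \<rho>\<close> by (auto simp: S_def)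
  qed
  then show ?thesis
    using Y(1) solves by blast
qed

text \<open>Solutions on growing intervals agree by uniqueness and glue together. The bound
  \<open>r\<close> may depend on \<open>N\<close> and \<open>y0\<close>, but not on the
  solution.\<close>

lemma solves_on_global:
  fixes F :: "'a::euclidean_space \<Rightarrow> 'a"
  assumes lip: "\<And>r. \<exists>L. L-lipschitz_on (cball 0 r) F"
    and apriori: "\<And>N. \<exists>r. \<forall>Y b. 0 < b \<and> b \<le> N \<and> Y 0 = y0 \<and> solves_on F {-b<..<b} Y \<longrightarrow>
        (\<forall>t\<in>{-b<..<b}. norm (Y t) \<le> r)"
  shows "\<exists>Y. Y 0 = y0 \<and> solves_on F UNIV Y"
proof -
  have "\<exists>Y. Y 0 = y0 \<and> solves_on F {- real (Suc n)<..<real (Suc n)} Y" for n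
  proof -
    obtain r where "\<And>Y b t. 0 < b \<Longrightarrow> b \<le> real (Suc n) \<Longrightarrow> Y 0 = y0 \<Longrightarrow>
        solves_on F {-b<..<b} Y \<Longrightarrow> t \<in> {-b<..<b} \<Longrightarrow> norm (Y t) \<le> r"
      using apriori[of "real (Suc n)"] by blast
    then show ?thesis
      by (intro solves_on_bounded_interval[OF lip, of "real (Suc n)" y0 r]) auto
  qed
  then obtain Y where Y: "\<And>n. Y n 0 = y0"
      "\<And>n. solves_on F {- real (Suc n)<..<real (Suc n)} (Y n)"
    by metis
  \<comment> \<open>The domain of \<open>Y n\<close> has radius \<open>n + 1\<close>, so rounding
    \<open>\<bar>t\<bar>\<close> up gives an index whose open interval contains
    \<open>t\<close>.\<close>
  define Z where "Z t = Y (nat \<lceil>\<bar>t\<bar>\<rceil>) t" for t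
  have Z: "Z t = Y n t" if "\<bar>t\<bar> < real (Suc n)" for n t
  proof -
    define m where "m = nat \<lceil>\<bar>t\<bar>\<rceil>"
    define k where "k = min m n"
    have "\<bar>t\<bar> < real (Suc m)"
      by (simp add: m_def) linarith
    then have t: "t \<in> {- real (Suc k)<..<real (Suc k)}"
      using that by (auto simp: k_def min_def)
    have "solves_on F {- real (Suc k)<..<real (Suc k)} (Y m)"
      "solves_on F {- real (Suc k)<..<real (Suc k)} (Y n)"
      by (auto intro!: solves_on_subset[OF Y(2)] simp: k_def)
    from solves_on_unique[OF lip _ _ t this, of 0] show ?thesis
      by (simp add: Y(1) Z_def m_def is_interval_convex)
  qed
  have "(Z has_vector_derivative F (Z t)) (at t)" for t
  proof -
    obtain n where "\<bar>t\<bar> < real n"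
      using reals_Archimedean2 by blast
    then have t: "t \<in> {- real (Suc n)<..<real (Suc n)}"
      by auto
    with Y(2) have "(Y n has_vector_derivative F (Y n t)) (at t)"
      by (auto simp: solves_on_def)
    then have "(Z has_vector_derivative F (Y n t)) (at t)"
      by (rule has_vector_derivative_transform_within_open[OF _ _ t]) (auto intro!: Z[symmetric])
    then show ?thesis
      using t Z[of t n] by (auto simp: abs_less_iff)
  qed
  moreover have "Z 0 = y0"
    by (simp add: Z_def Y(1))
  ultimately show ?thesis
    by (auto simp: solves_on_def)
qed

section \<open>The dual metric of a pp-wave\<close>

text \<open>Mean value inequality on an interval that also contains 0. It turns velocity bounds into
  position bounds for times below \<open>N\<close>.\<close>

lemma norm_increment_le:
  fixes f :: "real \<Rightarrow> 'z::real_normed_vector"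
  assumes f': "\<And>s. s \<in> {-b<..<b} \<Longrightarrow> (f has_vector_derivative f' s) (at s)"
    and le: "\<And>s. s \<in> {-b<..<b} \<Longrightarrow> norm (f' s) \<le> C"
    and t: "t \<in> {-b<..<b}" and "b \<le> N"
  shows "norm (f t - f 0) \<le> C * N"
proof -
  have "C \<ge> 0"
    using le[OF t] norm_ge_zero order_trans by blast
  have "norm (f t - f 0) \<le> C * norm (t - 0)"
  proof (rule differentiable_bound[of "{-b<..<b}" f "\<lambda>s h. h *\<^sub>R f' s"])
    show "onorm (\<lambda>h. h *\<^sub>R f' s) \<le> C" if "s \<in> {-b<..<b}" for s
      using le[OF that] by (intro onorm_le) (simp add: mult.commute[of C] mult_left_mono)
    show "(f has_derivative (\<lambda>h. h *\<^sub>R f' s)) (at s within {-b<..<b})" if "s \<in> {-b<..<b}" for s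
      using f'[OF that] unfolding has_vector_derivative_def by (rule has_derivative_at_withinI)
  qed (use t in auto)
  also have "\<dots> \<le> C * N"
    using t \<open>b \<le> N\<close> \<open>C \<ge> 0\<close> by (intro mult_left_mono) auto
  finally show ?thesis .
qed

text \<open>\<open>F\<close> is the geodesic equation as a first-order system for position and
  velocity. The global solution with the data of \<open>\<gamma>\<close> at one time agrees with it
  on \<open>I\<close> by uniqueness.\<close>

lemma geodesically_completeI:
  fixes g :: "'a::euclidean_space tensor2"
  defines "F \<equiv> \<lambda>(p, w). (w, - christoffel g p w w)"
  assumes lip: "\<And>r. \<exists>L. L-lipschitz_on (cball 0 r) F"
    and global: "\<And>y. \<exists>Y. Y 0 = y \<and> solves_on F UNIV Y"
  shows "geodesically_complete g"
  unfolding geodesically_complete_def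
proof (intro allI impI, elim conjE)
  fix I :: "real set" and \<gamma>
  assume "is_interval I" "I \<noteq> {}" "geodesic_on g I \<gamma>"
  then obtain a where "a \<in> I"
    by blast
  obtain \<gamma>' where \<gamma>': "(\<gamma> has_vector_derivative \<gamma>' t) (at t)"
      "(\<gamma>' has_vector_derivative - christoffel g (\<gamma> t) (\<gamma>' t) (\<gamma>' t)) (at t)" if "t \<in> I" for t
    using \<open>geodesic_on g I \<gamma>\<close> unfolding geodesic_on_def by blast
  have \<gamma>: "solves_on F I (\<lambda>t. (\<gamma> t, \<gamma>' t))"
    using \<gamma>' unfolding solves_on_def F_def by (auto intro!: has_vector_derivative_Pair)
  obtain Y where Y: "Y 0 = (\<gamma> a, \<gamma>' a)" "solves_on F UNIV Y"
    using global by blast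
  \<comment> \<open>The system is autonomous, so the initial time can be moved from 0 to
    \<open>a\<close>.\<close>
  define Z where "Z t = Y (t - a)" for t
  have Z: "(Z has_vector_derivative F (Z t)) (at t)" for t
  proof -
    have "(Y \<circ> (\<lambda>t. t - a) has_vector_derivative 1 *\<^sub>R F (Y (t - a))) (at t)"
      using Y(2) by (intro vector_diff_chain_at) (auto simp: solves_on_def intro!: derivative_eq_intros)
    then show ?thesis
      by (simp add: Z_def[abs_def] o_def)
  qed
  have "geodesic_on g UNIV (\<lambda>t. fst (Z t))"
    unfolding geodesic_on_def
  proof (intro exI[of _ "\<lambda>t. snd (Z t)"] ballI conjI)
    fix t
    show "((\<lambda>t. fst (Z t)) has_vector_derivative snd (Z t)) (at t)"
      using bounded_linear.has_vector_derivative[OF bounded_linear_fst Z] by (simp add: F_def split_beta)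
    show "((\<lambda>t. snd (Z t)) has_vector_derivative
        - christoffel g (fst (Z t)) (snd (Z t)) (snd (Z t))) (at t)"
      using bounded_linear.has_vector_derivative[OF bounded_linear_snd Z] by (simp add: F_def split_beta)
  qed
  moreover have "Z t = (\<gamma> t, \<gamma>' t)" if "t \<in> I" for t
  proof (rule solves_on_unique[OF lip \<open>is_interval I\<close> \<open>a \<in> I\<close> that _ \<gamma>])
    show "solves_on F I Z"
      using Z by (simp add: solves_on_def)
    show "Z a = (\<gamma> a, \<gamma>' a)"
      using Y(1) by (simp add: Z_def)
  qed
  ultimately show "\<exists>\<delta>. geodesic_on g UNIV \<delta> \<and> (\<forall>t\<in>I. \<delta> t = \<gamma> t)"
    by (intro exI[of _ "\<lambda>t. fst (Z t)"]) auto
qed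

text \<open>The Koszul equations have a unique solution, so any explicit candidate is identified by
  checking them.\<close>

lemma christoffelI:
  assumes "riemannian_metric g" "\<And>Z. g p W Z = koszul g p X Y Z"
  shows "christoffel g p X Y = W"
  using christoffel[OF assms(1)] christoffel_unique_existence[OF assms(1)] assms(2) by metis

text \<open>The 1-form \<open>dv + (H/2) du\<close>, which is half the \<open>g\<close>-dual of \<open>\<partial>\<^sub>v\<close>.\<close>

definition theta :: "('m::finite spacetime \<Rightarrow> real) \<Rightarrow> 'm spacetime \<Rightarrow> 'm spacetime \<Rightarrow> real" where
  "theta H p X = fst X + H p / 2 * fst (snd X)"

text \<open>Here \<open>h\<close> is \<open>theta\<close> du + du \<open>theta\<close> + |dx|^2 as a
  symmetric form (du \<open>theta\<close> once in each order) and the 1-form dual to T is du/2 -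
  \<open>theta\<close>. Adding twice the square of the latter cancels the mixed terms.\<close>

lemma pp_wave_dual_eq:
  "riemannian_dual (pp_wave H) (T_field H) p X Y =
     2 * theta H p X * theta H p Y + fst (snd X) * fst (snd Y) / 2 + snd (snd X) \<bullet> snd (snd Y)"
  by (simp add: riemannian_dual_def flat_def pp_wave_def T_field_def theta_def partial_v_def
      partial_u_def dv_def du_def dx_def inner_vec_def field_simps)

lemma pp_wave_dual_pos:
  assumes "X \<noteq> 0"
  shows "riemannian_dual (pp_wave H) (T_field H) p X X > 0"
proof (cases "snd X = 0")
  case True
  then have "fst X \<noteq> 0"
    using assms by (simp add: prod_eq_iff)
  with True show ?thesis
    by (auto simp: pp_wave_dual_eq theta_def zero_less_mult_iff linorder_neq_iff)
next
  case False
  then have "fst (snd X) * fst (snd X) / 2 + snd (snd X) \<bullet> snd (snd X) > 0"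
    by (cases "fst (snd X) = 0")
       (auto simp: prod_eq_iff zero_less_mult_iff linorder_neq_iff intro!: add_pos_nonneg)
  moreover have "2 * theta H p X * theta H p X \<ge> 0"
    by (simp add: mult.assoc)
  ultimately show ?thesis
    unfolding pp_wave_dual_eq by linarith
qed

lemma riemannian_metric_pp_wave_dual:
  assumes "smooth_map H"
  shows "riemannian_metric (riemannian_dual (pp_wave H) (T_field H))"
  unfolding riemannian_metric_def
proof (intro conjI allI impI)
  fix p X Y :: "'a spacetime"
  show "bilinear (riemannian_dual (pp_wave H) (T_field H) p)"
    unfolding bilinear_def
    by (auto intro!: linearI simp: pp_wave_dual_eq theta_def inner_add_left inner_add_right algebra_simps
        add_divide_distrib)
  show "riemannian_dual (pp_wave H) (T_field H) p X Y = riemannian_dual (pp_wave H) (T_field H) p Y X"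
    by (simp add: pp_wave_dual_eq inner_commute)
  show "smooth_map (\<lambda>p. riemannian_dual (pp_wave H) (T_field H) p X Y)"
    unfolding pp_wave_dual_eq theta_def divide_inverse using assms
    by (intro smooth_intros)
qed (rule pp_wave_dual_pos)

section \<open>Christoffel symbols and geodesic flow\<close>

context
  fixes H :: "'m::finite spacetime \<Rightarrow> real"
  assumes smooth: "smooth_map H"
    and v_indep: "\<And>v v' u x. H (v, u, x) = H (v', u, x)"
begin

abbreviation "DH p \<equiv> frechet_derivative H (at p)"

abbreviation "dual_metric \<equiv> riemannian_dual (pp_wave H) (T_field H)"

definition grad_x :: "'m spacetime \<Rightarrow> real ^ 'm" where
  "grad_x p = (\<Sum>i\<in>UNIV. DH p (0, 0, axis i 1) *\<^sub>R axis i 1)"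

text \<open>\<open>W = christoffel_diag p X\<close> solves the Koszul equations
  \<open>\<theta>(W) = dH(X) X\<^sup>u / 2\<close>, \<open>W\<^sup>u = 2 \<theta>(X) \<partial>\<^sub>xH \<bullet> X\<^sup>x\<close>, \<open>W\<^sup>x = - X\<^sup>u \<theta>(X) \<partial>\<^sub>xH\<close>.\<close>

definition christoffel_diag :: "'m spacetime \<Rightarrow> 'm spacetime \<Rightarrow> 'm spacetime" where
  "christoffel_diag p X = (let s = 2 * theta H p X * (grad_x p \<bullet> snd (snd X)) in
     ((DH p (0, 1, 0) * fst (snd X) + grad_x p \<bullet> snd (snd X)) * fst (snd X) / 2 - H p / 2 * s,
      s,
      - (fst (snd X) * theta H p X) *\<^sub>R grad_x p))"

lemma H_has_derivative: "(H has_derivative DH p) (at p)"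
  by (rule smooth_map_has_derivative[OF smooth])

lemma linear_DH: "linear (DH p)"
  using H_has_derivative has_derivative_linear by blast

text \<open>Independence of v enters here and once more in \<open>flow_bounded\<close>, where
  \<open>H\<close> is bounded by its values on the slice v = 0.\<close>

lemma DH_partial_v: "DH p (1, 0, 0) = 0"
proof (rule frechet_derivative_invariant_direction)
  show "H differentiable at p"
    by (rule smooth_map_differentiable[OF smooth])
  show "H (p + t *\<^sub>R (1, 0, 0)) = H p" for t
    using v_indep[of "fst p + t" "fst (snd p)" "snd (snd p)" "fst p"] by (cases p) auto
qed

lemma DH_eq: "DH p X = DH p (0, 1, 0) * fst (snd X) + grad_x p \<bullet> snd (snd X)"
proof -
  obtain a b x where X: "X = (a, b, x)"
    by (cases X) auto
  have x: "(\<Sum>i\<in>UNIV. (x $ i) *\<^sub>R (0, 0, axis i 1)) = (0::real, 0::real, x)"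
    using basis_expansion[of x] by (simp add: prod_eq_iff fst_sum snd_sum scalar_mult_eq_scaleR)
  have "X = a *\<^sub>R (1, 0, 0) + b *\<^sub>R (0, 1, 0) + (\<Sum>i\<in>UNIV. (x $ i) *\<^sub>R (0, 0, axis i 1))"
    unfolding X x by simp
  also have "DH p \<dots> = b * DH p (0, 1, 0) + (\<Sum>i\<in>UNIV. x $ i * DH p (0, 0, axis i 1))"
    unfolding linear_add[OF linear_DH] linear_cmul[OF linear_DH] linear_sum[OF linear_DH] DH_partial_v
    by simp
  also have "(\<Sum>i\<in>UNIV. x $ i * DH p (0, 0, axis i 1)) = grad_x p \<bullet> x"
    by (simp add: grad_x_def inner_sum_left inner_axis' mult.commute)
  finally show ?thesis
    by (simp add: X)
qed

lemma theta_christoffel_diag: "theta H p (christoffel_diag p X) = DH p X * fst (snd X) / 2"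
  by (simp add: theta_def christoffel_diag_def Let_def DH_eq[of p X])

text \<open>The base point enters the metric only through \<open>theta\<close>, whose derivative in
  direction \<open>A\<close> is \<open>DH p A / 2\<close> times du.\<close>

lemma frechet_derivative_metric:
  "frechet_derivative (\<lambda>q. dual_metric q Y Z) (at p) A =
     DH p A * (fst (snd Y) * theta H p Z + theta H p Y * fst (snd Z))"
proof -
  have "((\<lambda>q. dual_metric q Y Z) has_derivative
      (\<lambda>A. DH p A * (fst (snd Y) * theta H p Z + theta H p Y * fst (snd Z)))) (at p)"
    unfolding pp_wave_dual_eq theta_def
    by (auto intro!: derivative_eq_intros H_has_derivative simp: field_simps)
  from fun_cong[OF frechet_derivative_at[OF this], of A] show ?thesis
    by simp
qed

text \<open>Equal arguments suffice, since the geodesic equation evaluates the Christoffel map only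
  on the velocity paired with itself.\<close>

lemma christoffel_pp_wave_dual: "christoffel dual_metric p X X = christoffel_diag p X"
proof (rule christoffelI[OF riemannian_metric_pp_wave_dual[OF smooth]])
  show "dual_metric p (christoffel_diag p X) Z = koszul dual_metric p X X Z" for Z
    unfolding koszul_def frechet_derivative_metric
    unfolding pp_wave_dual_eq theta_christoffel_diag
    unfolding DH_eq[of p X] DH_eq[of p Z] by (simp add: christoffel_diag_def Let_def field_simps)
qed

definition flow :: "'m spacetime \<times> 'm spacetime \<Rightarrow> 'm spacetime \<times> 'm spacetime" where
  "flow = (\<lambda>(p, w). (w, - christoffel dual_metric p w w))"

text \<open>The definite description in \<open>christoffel\<close> hides smoothness; the explicit
  \<open>christoffel_diag\<close> shows it term by term.\<close>

lemma smooth_map_flow: "smooth_map flow"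
proof -
  have H: "smooth_map (\<lambda>y. H (fst y))"
    by (rule smooth_map_linear_preimage[OF bounded_linear_fst smooth])
  have DH: "smooth_map (\<lambda>y. DH (fst y) c)" for c
    by (rule smooth_map_linear_preimage[OF bounded_linear_fst smooth_map_frechet_derivative[OF smooth]])
  have grad: "smooth_map (\<lambda>y. grad_x (fst y))"
    unfolding grad_x_def by (intro smooth_map_sum smooth_intros DH) auto
  have "flow = (\<lambda>y. (snd y, - christoffel_diag (fst y) (snd y)))"
    by (simp add: flow_def christoffel_pp_wave_dual fun_eq_iff)
  moreover have "smooth_map (\<lambda>y. (snd y, - christoffel_diag (fst y) (snd y)))"
    unfolding christoffel_diag_def Let_def theta_def divide_inverse diff_conv_add_uminus
    by (intro smooth_intros H DH grad)
  ultimately show ?thesis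
    by simp
qed

section \<open>Conserved quantities and completeness\<close>

text \<open>The value of \<open>theta\<close> on the velocity is half its product with
  \<open>partial_v\<close>, the conserved momentum of that symmetry. \<open>E\<close> is the squared
  speed minus twice the square of this momentum.\<close>

lemma flow_conserved:
  assumes "solves_on flow {a<..<b} Y" "s \<in> {a<..<b}" "t \<in> {a<..<b}"
  defines "E \<equiv> \<lambda>t. (fst (snd (snd (Y t))))\<^sup>2 / 2 + snd (snd (snd (Y t))) \<bullet> snd (snd (snd (Y t)))"
  shows "theta H (fst (Y s)) (snd (Y s)) = theta H (fst (Y t)) (snd (Y t))" "E s = E t"
proof -
  have const: "f s = f t" if "\<And>r. r \<in> {a<..<b} \<Longrightarrow> (f has_vector_derivative 0) (at r)" for f :: "real \<Rightarrow> real"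
  proof -
    have "\<exists>c. \<forall>r\<in>{a<..<b}. f r = c"
      using that by (intro has_derivative_zero_constant)
        (auto simp: has_vector_derivative_def intro: has_derivative_at_withinI)
    then show ?thesis
      using assms(2,3) by metis
  qed
  have deriv: "((\<lambda>t. theta H (fst (Y t)) (snd (Y t))) has_vector_derivative 0) (at r) \<and>
      (E has_vector_derivative 0) (at r)" if "r \<in> {a<..<b}" for r
  proof -
    define p w where "p = fst (Y r)" and "w = snd (Y r)"
    have Y: "(Y has_vector_derivative (w, - christoffel_diag p w)) (at r)"
      using assms(1) that by (auto simp: solves_on_def flow_def p_def w_def christoffel_pp_wave_dual split_beta)
    note fst' = bounded_linear.has_vector_derivative[OF bounded_linear_fst]
    note snd' = bounded_linear.has_vector_derivative[OF bounded_linear_snd]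
    have "((\<lambda>t. fst (Y t)) has_derivative (\<lambda>h. h *\<^sub>R w)) (at r)"
      using fst'[OF Y] by (simp add: has_vector_derivative_def)
    from has_derivative_compose[OF this H_has_derivative]
    have "((\<lambda>t. H (fst (Y t))) has_vector_derivative DH p w) (at r)"
      by (simp add: has_vector_derivative_def p_def linear_cmul[OF linear_DH])
    then have H': "((\<lambda>t. H (fst (Y t))) has_real_derivative DH p w) (at r)"
      by (simp add: has_real_derivative_iff_has_vector_derivative)
    have v': "((\<lambda>t. fst (snd (Y t))) has_real_derivative - fst (christoffel_diag p w)) (at r)"
      using fst'[OF snd'[OF Y]] by (simp add: has_real_derivative_iff_has_vector_derivative)
    have u': "((\<lambda>t. fst (snd (snd (Y t)))) has_real_derivative - fst (snd (christoffel_diag p w))) (at r)"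
      using fst'[OF snd'[OF snd'[OF Y]]] by (simp add: has_real_derivative_iff_has_vector_derivative)
    have x': "((\<lambda>t. snd (snd (snd (Y t)))) has_vector_derivative - snd (snd (christoffel_diag p w))) (at r)"
      using snd'[OF snd'[OF snd'[OF Y]]] by simp
    have "((\<lambda>t. theta H (fst (Y t)) (snd (Y t))) has_real_derivative
        DH p w * fst (snd w) / 2 - theta H p (christoffel_diag p w)) (at r)"
      unfolding theta_def
      by (auto intro!: derivative_eq_intros H' v' u' simp: p_def w_def field_simps)
    moreover have "((\<lambda>t. snd (snd (snd (Y t))) \<bullet> snd (snd (snd (Y t)))) has_real_derivative
        - 2 * (snd (snd w) \<bullet> snd (snd (christoffel_diag p w)))) (at r)"
      using bounded_bilinear.has_vector_derivative[OF bounded_bilinear_inner x' x']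
      by (simp add: has_real_derivative_iff_has_vector_derivative w_def inner_commute)
    then have "(E has_real_derivative - fst (snd w) * fst (snd (christoffel_diag p w))
        - 2 * (snd (snd w) \<bullet> snd (snd (christoffel_diag p w)))) (at r)"
      unfolding E_def by (auto intro!: derivative_eq_intros u' simp: w_def)
    \<comment> \<open>The acceleration of (u, x) acts like a magnetic force: it is orthogonal to the
      velocity in the base metric and does no work.\<close>
    moreover have "- fst (snd w) * fst (snd (christoffel_diag p w)) - 2 * (snd (snd w) \<bullet> snd (snd (christoffel_diag p w))) = 0"
      by (simp add: christoffel_diag_def Let_def inner_commute)
    ultimately show ?thesis
      by (simp add: theta_christoffel_diag has_real_derivative_iff_has_vector_derivative)
  qed
  show "theta H (fst (Y s)) (snd (Y s)) = theta H (fst (Y t)) (snd (Y t))" "E s = E t"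
    using deriv by (auto intro!: const)
qed

lemma flow_bounded:
  "\<exists>r. \<forall>Y b. 0 < b \<and> b \<le> N \<and> Y 0 = y0 \<and> solves_on flow {-b<..<b} Y \<longrightarrow>
     (\<forall>t\<in>{-b<..<b}. norm (Y t) \<le> r)"
proof -
  obtain p0 w0 where y0: "y0 = (p0, w0)"
    by (cases y0)
  define E where "E w = (fst (snd w))\<^sup>2 / 2 + snd (snd w) \<bullet> snd (snd w)" for w :: "'m spacetime"
  \<comment> \<open>\<open>R\<close> bounds the (u, x)-velocity; the factor 2 compensates for the
    half in front of the squared u-component. \<open>S\<close> then bounds (u, x) itself up to time
    \<open>N\<close>.\<close>
  define R where "R = sqrt (2 * E w0)"
  define S where "S = norm (snd p0) + R * N"
  have "compact ((\<lambda>z. H (0, z)) ` cball 0 S)"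
    by (intro compact_continuous_image continuous_on_compose2[OF smooth_map_continuous_on[OF smooth]]
        continuous_intros) auto
  then have "bounded ((\<lambda>z. H (0, z)) ` cball 0 S)"
    by (rule compact_imp_bounded)
  then obtain M where "\<forall>y\<in>(\<lambda>z. H (0, z)) ` cball 0 S. norm y \<le> M"
    unfolding bounded_iff by (elim exE)
  then have M: "\<bar>H (0, z)\<bar> \<le> M" if "norm z \<le> S" for z
    using that by simp
  \<comment> \<open>The first two terms bound the v-velocity, recovered from \<open>theta\<close>
    with \<open>H\<close> at most \<open>M\<close>; the last one bounds the (u, x)-velocity.\<close>
  define Q where "Q = \<bar>theta H p0 w0\<bar> + M / 2 * R + R"
  show ?thesis
  proof (intro exI[of _ "norm p0 + Q * N + Q"] allI impI ballI; elim conjE)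
    fix Y b t
    assume "0 < b" "b \<le> N" "Y 0 = y0" and Y: "solves_on flow {-b<..<b} Y" and t: "t \<in> {-b<..<b}"
    define p w where "p s = fst (Y s)" and "w s = snd (Y s)" for s
    have p_0: "p 0 = p0"
      using \<open>Y 0 = y0\<close> by (simp add: p_def y0)
    have p': "(p has_vector_derivative w s) (at s)" if "s \<in> {-b<..<b}" for s
    proof -
      have "(Y has_vector_derivative flow (Y s)) (at s)"
        using Y that by (simp add: solves_on_def)
      from bounded_linear.has_vector_derivative[OF bounded_linear_fst this]
      show ?thesis
        by (simp add: p_def[abs_def] w_def flow_def split_beta)
    qed
    have cons: "theta H (p s) (w s) = theta H p0 w0" "E (w s) = E w0" if "s \<in> {-b<..<b}" for s
      using flow_conserved[OF Y that, of 0] \<open>0 < b\<close> \<open>Y 0 = y0\<close> by (simp_all add: p_def w_def y0 E_def)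
    have base: "norm (snd (w s)) \<le> R" if "s \<in> {-b<..<b}" for s
    proof -
      have "(norm (snd (w s)))\<^sup>2 \<le> 2 * E (w s)"
        by (simp add: E_def norm_prod_def dot_square_norm)
      then show ?thesis
        unfolding R_def cons(2)[OF that, symmetric] by (rule real_le_rsqrt)
    qed
    have "norm (snd (p s)) \<le> S" if "s \<in> {-b<..<b}" for s
    proof -
      have "norm (snd (p s) - snd (p 0)) \<le> R * N"
        using bounded_linear.has_vector_derivative[OF bounded_linear_snd p'] base that \<open>b \<le> N\<close>
        by (rule norm_increment_le)
      then show ?thesis
        using norm_triangle_ineq2[of "snd (p s)" "snd (p 0)"] p_0 by (simp add: S_def)
    qed
    then have H: "\<bar>H (p s)\<bar> \<le> M" if "s \<in> {-b<..<b}" for s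
      using M[of "snd (p s)"] that v_indep[of 0 "fst (snd (p s))" "snd (snd (p s))" "fst (p s)"] by simp
    have w: "norm (w s) \<le> Q" if "s \<in> {-b<..<b}" for s
    proof -
      have "\<bar>fst (snd (w s))\<bar> \<le> R"
        using base[OF that] norm_fst_le[of "fst (snd (w s))" "snd (snd (w s))"] by simp
      then have "\<bar>H (p s) / 2 * fst (snd (w s))\<bar> \<le> M / 2 * R"
        unfolding abs_mult using H[OF that] by (intro mult_mono) auto
      then have "\<bar>fst (w s)\<bar> \<le> \<bar>theta H p0 w0\<bar> + M / 2 * R"
        using cons(1)[OF that] by (simp add: theta_def)
      then show ?thesis
        using norm_Pair_le[of "fst (w s)" "snd (w s)"] base[OF that] by (simp add: Q_def)
    qed
    have "norm (p t - p 0) \<le> Q * N"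
      using p' w t \<open>b \<le> N\<close> by (rule norm_increment_le)
    then have "norm (p t) \<le> norm p0 + Q * N"
      using norm_triangle_ineq2[of "p t" "p 0"] p_0 by simp
    then show "norm (Y t) \<le> norm p0 + Q * N + Q"
      using norm_Pair_le[of "p t" "w t"] w[OF t] by (simp add: p_def w_def)
  qed
qed

lemma geodesically_complete_pp_wave_dual: "geodesically_complete dual_metric"
proof (rule geodesically_completeI; fold flow_def)
  show lip: "\<exists>L. L-lipschitz_on (cball 0 r) flow" for r
    by (rule smooth_map_lipschitz_cball[OF smooth_map_flow])
  show "\<exists>Y. Y 0 = y \<and> solves_on flow UNIV Y" for y
    by (rule solves_on_global[OF lip flow_bounded])
qed

text \<open>As \<open>partial_v\<close> is constant, its bracket with \<open>Y\<close> is the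
  derivative of \<open>Y\<close> along it. The product rule terms cancel against the brackets,
  leaving the derivative of the coefficients, a multiple of \<open>DH p (1, 0, 0)\<close>.\<close>

lemma killing_field_partial_v: "killing_field dual_metric partial_v"
  unfolding killing_field_def
proof (intro conjI allI impI)
  have partial_v: "partial_v = (\<lambda>p. (1, 0, 0))"
    by (simp add: fun_eq_iff partial_v_def)
  show "smooth_map (partial_v :: 'm spacetime \<Rightarrow> _)"
    unfolding partial_v by (rule smooth_map_const)
  fix Y Z :: "'m spacetime \<Rightarrow> 'm spacetime" and p
  assume "smooth_map Y \<and> smooth_map Z"
  then have Y: "(Y has_derivative frechet_derivative Y (at p)) (at p)"
    and Z: "(Z has_derivative frechet_derivative Z (at p)) (at p)"
    by (auto intro: smooth_map_has_derivative)
  have theta': "((\<lambda>q. theta H q (X q)) has_derivative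
      (\<lambda>A. theta H p (D A) + DH p A / 2 * fst (snd (X p)))) (at p)"
    if "(X has_derivative D) (at p)" for X D
    unfolding theta_def by (auto intro!: derivative_eq_intros H_has_derivative that simp: field_simps)
  have "((\<lambda>q. dual_metric q (Y q) (Z q)) has_derivative
      (\<lambda>A. dual_metric p (frechet_derivative Y (at p) A) (Z p) + dual_metric p (Y p) (frechet_derivative Z (at p) A)
        + DH p A * (fst (snd (Y p)) * theta H p (Z p) + theta H p (Y p) * fst (snd (Z p))))) (at p)"
    unfolding pp_wave_dual_eq
    by (auto intro!: derivative_eq_intros theta' Y Z simp: field_simps)
  from fun_cong[OF frechet_derivative_at[OF this], of "(1, 0, 0)"]
  show "lie_derivative partial_v dual_metric Y Z p = 0"
    by (simp add: lie_derivative_def lie_bracket_def partial_v DH_partial_v)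
qed

end

text \<open>Only \<open>theta\<close> is nonzero on \<open>partial_v\<close>, with value 1, so the
  length is the square root of 2.\<close>

lemma constant_length_partial_v:
  "constant_length (riemannian_dual (pp_wave H) (T_field H)) partial_v"
  by (simp add: constant_length_def pp_wave_dual_eq theta_def partial_v_def)

theorem proposition1:
  fixes H :: "real \<times> real \<times> (real ^ 'm::finite) \<Rightarrow> real"
    and h g :: "'m spacetime tensor2"
    and T :: "'m spacetime \<Rightarrow> 'm spacetime"
  assumes "smooth_map H"
    and "\<And>v v' u x. H (v, u, x) = H (v', u, x)"
    and "h = pp_wave H"
    and "T = T_field H"
    and "g = riemannian_dual h T"
  shows "riemannian_metric g \<and> geodesically_complete g \<and>
    killing_field g partial_v \<and> constant_length g partial_v"
  using riemannian_metric_pp_wave_dual[OF assms(1)] geodesically_complete_pp_wave_dual[OF assms(1,2)]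
    killing_field_partial_v[OF assms(1,2)] constant_length_partial_v[of H]
  by (simp add: assms(3-5))

end
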